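(* Let $a\in\mathbb{R}$. Then $\lim_{\varepsilon\to0^+}J^{1-\varepsilon}=J^1$, that is, for every $f\in E$ and every $x>a$, $$\lim_{\varepsilon\to0^+}J^{1-\varepsilon}(f)(x)=J^1(f)(x)=\int_a^x f(y)\,dy.$$
   Context: $E$ denotes the set of integrable and derivable causal functions $f$ on $I=\,]a,+\infty[$: complex-valued functions, differentiable on $]a,+\infty[$, integrable on $]a,x[$ for every $x>a$, and extended by $f(x)=0$ for $x\le a$. For real $s>0$, the $s$-order integral operator is $$J^s(f)(x)=\frac{1}{\Gamma(s)}\int_a^x (x-y)^{s-1}f(y)\,dy,\qquad x>a,$$ where $\Gamma$ is Euler's gamma function. *)

theory Defs
  imports "HOL-Analysis.Analysis"
begin

definition causal_E :: "real \<Rightarrow> (real \<Rightarrow> complex) set" where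
  "causal_E a = {f. f differentiable_on {a<..}
                  \<and> (\<forall>x>a. set_integrable lborel {a<..<x} f)
                  \<and> (\<forall>x\<le>a. f x = 0)}"

text \<open>
  The integral is a Lebesgue integral. The operator is meant for \<open>s > 0\<close>; for \<open>x \<le> a\<close> the
  domain of integration is empty, so the value is 0 and the result is again causal.
\<close>

definition frac_int :: "real \<Rightarrow> real \<Rightarrow> (real \<Rightarrow> complex) \<Rightarrow> real \<Rightarrow> complex" where
  "frac_int a s f x =
     (1 / Gamma s) *\<^sub>R (LINT y:{a<..<x}|lborel. ((x - y) powr (s - 1)) *\<^sub>R f y)"

end

theory Submission
  imports Defs
begin

text \<open>
  Continuity of \<open>f\<close> at the endpoint \<open>x\<close> makes \<open>f\<close> bounded by some \<open>M\<close> on an interval \<open>(m, x)\<close>.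
  For \<open>\<epsilon> < 1/2\<close> the kernel \<open>(x - y) powr (-\<epsilon>)\<close> is at most \<open>1 + (x - y) powr (-1/2)\<close>, which is
  bounded on \<open>(a, m]\<close> and integrable up to \<open>x\<close>. Hence dominated convergence applies, with majorant
  a multiple of \<open>|f|\<close> plus \<open>M (x - y) powr (-1/2)\<close>; finally \<open>Gamma (1 - \<epsilon>)\<close> tends to 1.
\<close>

text \<open>The antiderivative \<open>- 2 * sqrt (x - y)\<close> stays continuous up to the singular
  endpoint, so the fundamental theorem for nonnegative integrands yields integrability.\<close>

lemma set_integrable_powr_minus_half:
  fixes a x :: real
  assumes "a < x"
  shows "set_integrable lborel {a<..<x} (\<lambda>y. (x - y) powr (-1/2))"
proof -
  let ?F = "\<lambda>y. - 2 * sqrt (x - y)"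
  have cont: "(?F \<longlongrightarrow> ?F y) (at y within S)" for y S
    by (intro tendsto_intros)
  have "set_integrable lborel (einterval (ereal a) (ereal x)) (\<lambda>y. (x - y) powr (-1/2))"
  proof (rule interval_integral_FTC_nonneg(1)[where F = ?F and A = "?F a" and B = "?F x"])
    show "((?F \<circ> real_of_ereal) \<longlongrightarrow> ?F a) (at_right (ereal a))"
      unfolding ereal_tendsto_simps1 by (rule cont)
    show "((?F \<circ> real_of_ereal) \<longlongrightarrow> ?F x) (at_left (ereal x))"
      unfolding ereal_tendsto_simps1 by (rule cont)
    show "DERIV ?F y :> (x - y) powr (-1/2)" if "ereal a < ereal y" "ereal y < ereal x" for y
    proof -
      have "(x - y) powr (-1/2) = inverse (sqrt (x - y))"
        using that powr_minus[of "x - y" "1/2"] by (simp add: powr_half_sqrt)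
      with that show ?thesis
        by (auto intro!: derivative_eq_intros)
    qed
  qed (use assms in \<open>auto intro!: continuous_intros\<close>)
  then show ?thesis by simp
qed

text \<open>For t up to 1 a smaller exponent gives a larger power; beyond 1 a nonpositive exponent
  gives at most 1. The sum covers both cases uniformly in \<open>e\<close>.\<close>

lemma powr_minus_le_one_plus_powr_minus_half:
  fixes t e :: real
  assumes "0 < t" "0 \<le> e" "e \<le> 1/2"
  shows "t powr (- e) \<le> 1 + t powr (-1/2)"
proof (cases "t \<le> 1")
  case True
  then have "t powr (- e) \<le> t powr (-1/2)"
    using assms by (intro powr_mono') auto
  then show ?thesis by simp
next
  case False
  then have "t powr (- e) \<le> t powr 0"
    using assms by (intro powr_mono) auto
  moreover have "t powr (-1/2) \<ge> 0" by (rule powr_ge_zero)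
  moreover have "t powr 0 = 1" using assms by simp
  ultimately show ?thesis by linarith
qed

lemma tendsto_powr_kernel_integral:
  fixes f :: "real \<Rightarrow> 'a::{banach, second_countable_topology}"
  assumes f: "set_integrable lborel {a<..<x} f"
    and m: "a < m" "m < x"
    and M: "\<And>y. m < y \<Longrightarrow> y < x \<Longrightarrow> norm (f y) \<le> M"
  shows "((\<lambda>\<epsilon>. LINT y:{a<..<x}|lborel. ((x - y) powr (- \<epsilon>)) *\<^sub>R f y)
           \<longlongrightarrow> (LINT y:{a<..<x}|lborel. f y)) (at_right 0)"
\<comment> \<open>Dominated convergence works along sequences; keeping them below 1/2 gives all
  kernels a common majorant.\<close>
proof (rule tendsto_at_right_sequentially[of _ "1/2"])
  fix S :: "nat \<Rightarrow> real"
  assume S: "\<And>n. 0 < S n" "\<And>n. S n < 1/2" "S \<longlonglongrightarrow> 0"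
  let ?i = "indicator {a<..<x} :: real \<Rightarrow> real"
  \<comment> \<open>The kernel bound increases with \<open>y\<close>, so its value at
    \<open>m\<close> bounds it on all of (a, m].\<close>
  define K where "K = 1 + (x - m) powr (-1/2)"
  let ?W = "\<lambda>y. K * norm (?i y *\<^sub>R f y) + M * (?i y *\<^sub>R (x - y) powr (-1/2))"
  have [measurable]: "(\<lambda>y. ?i y *\<^sub>R f y) \<in> borel_measurable lborel"
    using f unfolding set_integrable_def by (rule borel_measurable_integrable)
  \<comment> \<open>\<open>M\<close> bounds a norm only at points of (m, x); the midpoint is such a
    point.\<close>
  have M0: "0 \<le> M"
    using M[of "(m + x) / 2"] m order_trans[OF norm_ge_zero] by simp
  show "(\<lambda>n. LINT y:{a<..<x}|lborel. ((x - y) powr (- S n)) *\<^sub>R f y)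
           \<longlonglongrightarrow> (LINT y:{a<..<x}|lborel. f y)"
    unfolding set_lebesgue_integral_def
  proof (rule integral_dominated_convergence[where w = ?W])
    show "(\<lambda>y. ?i y *\<^sub>R (x - y) powr (- S n) *\<^sub>R f y) \<in> borel_measurable lborel" for n
    proof -
      \<comment> \<open>Measurability of \<open>f\<close> is known only after cutting off by the
        indicator, so the kernel is moved outside that product.\<close>
      have "(\<lambda>y. (x - y) powr (- S n) *\<^sub>R (?i y *\<^sub>R f y)) \<in> borel_measurable lborel"
        by measurable
      then show ?thesis by (simp add: mult.commute)
    qed
    have "integrable lborel (\<lambda>y. norm (?i y *\<^sub>R f y))"
      using f unfolding set_integrable_def by (rule integrable_norm)
    moreover have "integrable lborel (\<lambda>y. ?i y *\<^sub>R (x - y) powr (-1/2))"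
      using set_integrable_powr_minus_half[of a x] m unfolding set_integrable_def by simp
    ultimately show "integrable lborel ?W"
      by (intro Bochner_Integration.integrable_add integrable_mult_right)
    have "(\<lambda>n. ?i y *\<^sub>R (x - y) powr (- S n) *\<^sub>R f y) \<longlonglongrightarrow> ?i y *\<^sub>R f y" for y
    proof (cases "y \<in> {a<..<x}")
      case True
      then have "(\<lambda>n. (x - y) powr (- S n)) \<longlonglongrightarrow> (x - y) powr (- 0)"
        by (intro tendsto_intros S) auto
      then have "(\<lambda>n. (x - y) powr (- S n) *\<^sub>R f y) \<longlonglongrightarrow> 1 *\<^sub>R f y"
        using True by (intro tendsto_intros) auto
      then show ?thesis using True by simp
    qed simp
    then show "AE y in lborel. (\<lambda>n. ?i y *\<^sub>R (x - y) powr (- S n) *\<^sub>R f y) \<longlonglongrightarrow> ?i y *\<^sub>R f y"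
      by simp
    have "norm (?i y *\<^sub>R (x - y) powr (- S n) *\<^sub>R f y) \<le> ?W y" for n y
    proof (cases "y \<in> {a<..<x}")
      case True
      let ?p = "(x - y) powr (-1/2)"
      have "(x - y) powr (- S n) \<le> 1 + ?p"
        using True less_imp_le[OF S(1)[of n]] less_imp_le[OF S(2)[of n]]
        by (intro powr_minus_le_one_plus_powr_minus_half) auto
      then have "norm ((x - y) powr (- S n) *\<^sub>R f y) \<le> (1 + ?p) * norm (f y)"
        by (simp add: mult_right_mono)
      \<comment> \<open>Up to \<open>m\<close> the first summand suffices. Past \<open>m\<close> the
        product is expanded: \<open>K\<close> is at least 1, and \<open>M\<close> replaces the norm
        in front of the singular factor.\<close>
      also have "\<dots> \<le> K * norm (f y) + M * ?p"
      proof (cases "m < y")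
        case False
        then have "?p \<le> (x - m) powr (-1/2)"
          using m by (intro powr_mono2') auto
        then have "(1 + ?p) * norm (f y) \<le> K * norm (f y)"
          unfolding K_def by (intro mult_right_mono) auto
        with M0 show ?thesis by (simp add: add_increasing2)
      next
        case True
        then have "norm (f y) * ?p \<le> M * ?p"
          using M[of y] \<open>y \<in> {a<..<x}\<close> by (intro mult_right_mono) auto
        moreover have "1 * norm (f y) \<le> K * norm (f y)"
          unfolding K_def by (intro mult_right_mono) auto
        ultimately show ?thesis by (simp add: algebra_simps)
      qed
      finally show ?thesis using True by simp
    qed simp
    then show "AE y in lborel. norm (?i y *\<^sub>R (x - y) powr (- S n) *\<^sub>R f y) \<le> ?W y" for n
      by simp
  qed simp
qed simp

lemma isCont_imp_bounded_on_left_interval: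
  fixes f :: "real \<Rightarrow> 'a::real_normed_vector"
  assumes "isCont f x" "a < x"
  obtains m M where "a < m" "m < x" "\<And>y. m < y \<Longrightarrow> y < x \<Longrightarrow> norm (f y) \<le> M"
proof -
  have "((\<lambda>y. norm (f y)) \<longlongrightarrow> norm (f x)) (at_left x)"
    using assms(1) by (intro tendsto_norm) (simp add: isCont_def filterlim_at_split)
  then have "eventually (\<lambda>y. norm (f y) < norm (f x) + 1) (at_left x)"
    by (rule order_tendstoD) simp
  then obtain b where b: "b < x" "\<And>y. b < y \<Longrightarrow> y < x \<Longrightarrow> norm (f y) < norm (f x) + 1"
    using assms(2) by (auto simp: eventually_at_left[OF assms(2)])
  show thesis
  proof
    \<comment> \<open>The point \<open>b\<close> may lie left of \<open>a\<close>; the maximum with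
      the midpoint keeps the new endpoint inside (a, x).\<close>
    show "a < max ((a + x) / 2) b" "max ((a + x) / 2) b < x"
      using assms(2) b(1) by (auto simp: less_max_iff_disj)
    show "norm (f y) \<le> norm (f x) + 1" if "max ((a + x) / 2) b < y" "y < x" for y
      using b(2)[of y] that by auto
  qed
qed

theorem theorem7:
  fixes a :: real
  shows "\<forall>f\<in>causal_E a. \<forall>x>a.
           ((\<lambda>\<epsilon>. frac_int a (1 - \<epsilon>) f x) \<longlongrightarrow> frac_int a 1 f x) (at_right 0)
         \<and> frac_int a 1 f x = (LINT y:{a<..<x}|lborel. f y)"
proof (intro ballI allI impI)
  fix f x assume "f \<in> causal_E a" and x: "a < x"
  then have diff: "f differentiable_on {a<..}" and int: "set_integrable lborel {a<..<x} f"
    by (auto simp: causal_E_def)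
  \<comment> \<open>Since the half-line is open, continuity on it is continuity at each of its
    points.\<close>
  have "isCont f x"
    using differentiable_imp_continuous_on[OF diff] x
    by (simp add: continuous_on_eq_continuous_at)
  then obtain m M where "a < m" "m < x" "\<And>y. m < y \<Longrightarrow> y < x \<Longrightarrow> norm (f y) \<le> M"
    using isCont_imp_bounded_on_left_interval[OF _ x] by blast
  note kernel = tendsto_powr_kernel_integral[OF int this]
  have one: "frac_int a 1 f x = (LINT y:{a<..<x}|lborel. f y)"
    unfolding frac_int_def
    \<comment> \<open>As \<open>0 powr 0\<close> is 0, the kernel of order 1 equals 1 only off y =
      x, a point that the open interval omits.\<close>
    by (simp, rule set_lebesgue_integral_cong) auto
  have "((\<lambda>\<epsilon>::real. 1 - \<epsilon>) \<longlongrightarrow> 1 - 0) (at_right 0)"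
    by (intro tendsto_intros)
  then have "((\<lambda>\<epsilon>::real. Gamma (1 - \<epsilon>)) \<longlongrightarrow> 1) (at_right 0)"
    using tendsto_Gamma[of "\<lambda>\<epsilon>::real. 1 - \<epsilon>" 1 "at_right 0"] by simp
  then have "((\<lambda>\<epsilon>::real. 1 / Gamma (1 - \<epsilon>)) \<longlongrightarrow> 1 / 1) (at_right 0)"
    by (intro tendsto_intros) auto
  from tendsto_scaleR[OF this kernel]
  show "((\<lambda>\<epsilon>. frac_int a (1 - \<epsilon>) f x) \<longlongrightarrow> frac_int a 1 f x) (at_right 0)
      \<and> frac_int a 1 f x = (LINT y:{a<..<x}|lborel. f y)"
    unfolding one by (simp add: frac_int_def)
qed

end
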